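(* Let $(X,d)$ be a compact metric space, let $f:X\to X$ be a continuous surjection, and let $\mathbb{F}=(f_n)_{n\in\mathbb{N}}$ be a sequence of continuous surjections $f_n:X\to X$ converging uniformly to $f$. If $x\in X$ is periodic for $(X,\mathbb{F})$, then $x$ is periodic for $(X,f)$.
   Context: For $\mathbb{F}=(f_n)_{n\in\mathbb{N}}$ (with $\mathbb{N}=\{1,2,\dots\}$), put $\omega_n=f_n\circ f_{n-1}\circ\cdots\circ f_1$; $(X,\mathbb{F})$ denotes the non-autonomous system with orbits $\{\omega_n(x):n\in\mathbb{N}\}$. A point $x$ is periodic for $(X,\mathbb{F})$ if there is $n\in\mathbb{N}$ such that $\omega_{nk}(x)=x$ for all $k\in\mathbb{N}$. A point $x$ is periodic for $(X,f)$ if $f^n(x)=x$ for some $n\in\mathbb{N}$. *)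

theory Defs
  imports "HOL-Analysis.Analysis"
begin

text \<open>
  A sequence of maps \<open>f\<^sub>1, f\<^sub>2, \<dots>\<close> is a function \<open>F\<close> on \<^typ>\<open>nat\<close> whose value at \<open>0\<close> is never used:
  \<open>omega F n = F n \<circ> \<dots> \<circ> F 1\<close>.
\<close>

primrec omega :: "(nat \<Rightarrow> 'a \<Rightarrow> 'a) \<Rightarrow> nat \<Rightarrow> 'a \<Rightarrow> 'a" where
  "omega F 0 = id"
| "omega F (Suc n) = F (Suc n) \<circ> omega F n"

definition nonautonomous_periodic :: "(nat \<Rightarrow> 'a \<Rightarrow> 'a) \<Rightarrow> 'a \<Rightarrow> bool" where
  "nonautonomous_periodic F x \<longleftrightarrow> (\<exists>n\<ge>1. \<forall>k\<ge>1. omega F (n * k) x = x)"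

definition autonomous_periodic :: "('a \<Rightarrow> 'a) \<Rightarrow> 'a \<Rightarrow> bool" where
  "autonomous_periodic f x \<longleftrightarrow> (\<exists>n\<ge>1. (f ^^ n) x = x)"

end

theory Submission
  imports Defs
begin

text \<open>
  Along the return times \<open>n * k\<close> the orbit of \<open>x\<close> under \<open>F\<close> restarts at \<open>x\<close>, with maps ever closer
  to \<open>f\<close>; hence \<open>omega F (n * k + j) x\<close> tends to \<open>(f ^^ j) x\<close> for each fixed \<open>j\<close>. For \<open>j = n\<close> the
  left-hand side is constantly \<open>x\<close>.
\<close>

text \<open>Triangle inequality through \<open>f (y k)\<close>: uniformity makes
  \<open>F (m k)\<close> close to \<open>f\<close> at the moving point \<open>y k\<close>, and
  continuity of \<open>f\<close> makes \<open>f (y k)\<close> close to \<open>f l\<close>.\<close>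

lemma uniform_limit_tendsto_compose:
  fixes f :: "'a::topological_space \<Rightarrow> 'b::metric_space"
  assumes unif: "uniform_limit X F f G" and cont: "continuous_on X f"
    and m: "filterlim m G H" and y: "(y \<longlongrightarrow> l) H"
    and l: "l \<in> X" and yX: "\<And>k. y k \<in> X"
  shows "((\<lambda>k. F (m k) (y k)) \<longlongrightarrow> f l) H"
proof (rule tendstoI)
  fix e :: real assume "e > 0"
  then have e: "e / 2 > 0" by simp
  have "((\<lambda>k. f (y k)) \<longlongrightarrow> f l) H"
    using continuous_on_tendsto_compose[OF cont y l] yX by simp
  then have 1: "\<forall>\<^sub>F k in H. dist (f (y k)) (f l) < e / 2"
    using e by (rule tendstoD)
  have "\<forall>\<^sub>F k in H. \<forall>z\<in>X. dist (F (m k) z) (f z) < e / 2"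
    using uniform_limitD[OF unif e] m by (rule eventually_compose_filterlim)
  with 1 show "\<forall>\<^sub>F k in H. dist (F (m k) (y k)) (f l) < e"
  proof eventually_elim
    case (elim k)
    then have "dist (F (m k) (y k)) (f (y k)) < e / 2" using yX by blast
    with elim(1) show ?case using dist_triangle_half_r dist_commute by metis
  qed
qed

lemma omega_in:
  assumes "\<And>n. n \<ge> 1 \<Longrightarrow> F n ` X \<subseteq> X" and "x \<in> X"
  shows "omega F n x \<in> X"
proof (induction n)
  case (Suc n)
  then show ?case using assms(1)[of "Suc n"] by auto
qed (use assms in simp)

text \<open>Induction on \<open>j\<close>: the next map applied has index
  \<open>Suc (n * k + j)\<close>, which tends to infinity with \<open>k\<close>, so the limit passes
  through it and picks up one more \<open>f\<close>.\<close>

lemma omega_return_tendsto: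
  fixes f :: "'a::metric_space \<Rightarrow> 'a"
  assumes unif: "uniform_limit X F f sequentially" and cont: "continuous_on X f"
    and fX: "f ` X \<subseteq> X" and FX: "\<And>n. n \<ge> 1 \<Longrightarrow> F n ` X \<subseteq> X" and x: "x \<in> X"
    and n: "n \<ge> 1" and return: "\<And>k. k \<ge> 1 \<Longrightarrow> omega F (n * k) x = x"
  shows "(\<lambda>k. omega F (n * k + j) x) \<longlonglongrightarrow> (f ^^ j) x"
proof (induction j)
  case 0
  \<comment> \<open>The returns are given from \<open>k = 1\<close> on; at \<open>k = 0\<close> the
    map is \<open>id\<close>.\<close>
  have "omega F (n * k) x = x" for k
    using return[of k] by (cases "k = 0") auto
  then show ?case by simp
next
  case (Suc j)
  have "(f ^^ j) x \<in> X" using fX x by (induction j) auto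
  \<comment> \<open>Here \<open>n \<ge> 1\<close> matters: for \<open>n = 0\<close> the index would
    not depend on \<open>k\<close>.\<close>
  moreover have "strict_mono (\<lambda>k. Suc (n * k + j))"
    using n by (auto intro!: strict_monoI)
  then have "filterlim (\<lambda>k. Suc (n * k + j)) sequentially sequentially"
    by (rule filterlim_subseq)
  ultimately have "(\<lambda>k. F (Suc (n * k + j)) (omega F (n * k + j) x)) \<longlonglongrightarrow> f ((f ^^ j) x)"
    using Suc omega_in[OF FX x] by (intro uniform_limit_tendsto_compose[OF unif cont]) auto
  then show ?case by simp
qed

theorem proposition9:
  fixes X :: "'a::metric_space set"
    and f :: "'a \<Rightarrow> 'a"
    and F :: "nat \<Rightarrow> 'a \<Rightarrow> 'a"
    and x :: 'a
  assumes "compact X"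
    and "continuous_on X f" and "f ` X = X"
    and "\<And>n. n \<ge> 1 \<Longrightarrow> continuous_on X (F n)"
    and "\<And>n. n \<ge> 1 \<Longrightarrow> F n ` X = X"
    and "uniform_limit X F f sequentially"
    and "x \<in> X"
    and "nonautonomous_periodic F x"
  shows "autonomous_periodic f x"
proof -
  obtain n where n: "n \<ge> 1" and return: "\<And>k. k \<ge> 1 \<Longrightarrow> omega F (n * k) x = x"
    using assms(8) unfolding nonautonomous_periodic_def by blast
  have "(\<lambda>k. omega F (n * k + n) x) \<longlonglongrightarrow> (f ^^ n) x"
    using assms n return by (intro omega_return_tendsto[where X = X]) auto
  \<comment> \<open>Since \<open>n * k + n = n * Suc k\<close>, this is again a return time, even
    for \<open>k = 0\<close>.\<close>
  moreover have "omega F (n * k + n) x = x" for k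
    using return[of "Suc k"] by (simp add: add.commute)
  ultimately have "(f ^^ n) x = x"
    by (simp add: LIMSEQ_const_iff)
  with n show ?thesis unfolding autonomous_periodic_def by blast
qed

end
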